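(* Let $a_1,a_2,\dots,a_n\in\mathbb{N}$ be pairwise coprime, let $x_1,x_2,\dots,x_n\in\mathbb{R}$, and let $y_1,y_2,\dots,y_n$ be nonzero variables such that $y_1+y_2+\cdots+y_n=0$. If $$\frac{x_u-h_u}{a_u}-\frac{x_v-h_v}{a_v}\notin\mathbb{Z}\quad\text{whenever } 1\le u<v\le n \text{ and } h_u,h_v\in\mathbb{Z},$$ then $$\sum_{k=1}^{n}\Omega\left(\begin{matrix} A_k & a_k \\ X_k & x_k \\ Y_k & \end{matrix}\right)=0 .$$
   Context: $\mathbb{N}=\{1,2,3,\dots\}$. The Bernoulli polynomials $B_k(u)$, $k\ge 0$, are defined by $\frac{e^{uz}}{e^z-1}=\sum_{k\ge 0}\frac{B_k(u)}{k!}z^{k-1}$. The periodized Bernoulli polynomial $\overline{B}_k(u)$ is the function of $u\in\mathbb{R}$ that is periodic with period $1$ and coincides with $B_k(u)$ on $[0,1)$, except that $\overline{B}_1(u)=0$ for $u\in\mathbb{Z}$. A hat denotes omission of an entry: $A_k=(a_1,\dots,\widehat{a_k},\dots,a_n)$, $X_k=(x_1,\dots,\widehat{x_k},\dots,x_n)$, $Y_k=(y_1,\dots,\widehat{y_k},\dots,y_n)$, $P_k=(p_1,\dots,\widehat{p_k},\dots,p_n)$ with nonnegative integers $p_i$. The Bernoulli--Dedekind sum is $$S_{P_k}\left(\begin{matrix} A_k & a_k \\ X_k & x_k\end{matrix}\right):=\sum_{h \bmod a_k}\ \prod_{\substack{i=1\\ i\ne k}}^{n}\overline{B}_{p_i}\left(a_i\frac{h+x_k}{a_k}-x_i\right),$$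 where $h$ runs over a complete residue system modulo $a_k$. For nonzero variables $y_1,\dots,y_n$, the generating function is $$\Omega\left(\begin{matrix} A_k & a_k \\ X_k & x_k \\ Y_k & \end{matrix}\right):=\sum_{(p_1,\dots,\widehat{p_k},\dots,p_n)\in\mathbb{Z}_{\ge 0}^{n-1}}\frac{1}{p_1!\cdots p_{k-1}!\,p_{k+1}!\cdots p_n!}\ S_{P_k}\left(\begin{matrix} A_k & a_k \\ X_k & x_k\end{matrix}\right)\prod_{\substack{i=1\\ i\ne k}}^{n}\left(\frac{y_i}{a_i}\right)^{p_i-1}.$$ *)

theory Defs
  imports
    "HOL-Analysis.Analysis"
    "HOL-Computational_Algebra.Formal_Laurent_Series"
begin

text \<open>
  The generating function \<open>e\<^sup>u\<^sup>z / (e\<^sup>z - 1) = (\<Sum>k\<ge>0. B\<^sub>k(u) / k! * z\<^sup>k\<^sup>-\<^sup>1)\<close>, with the quotient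
  taken in the field of formal Laurent series in \<open>z\<close>.
\<close>

definition bernoulli_poly :: "nat \<Rightarrow> real \<Rightarrow> real" where
  "bernoulli_poly k u =
     fact k * fls_nth (fps_to_fls (fps_exp u) / (fps_to_fls (fps_exp 1) - 1)) (int k - 1)"

definition periodized_bernoulli :: "nat \<Rightarrow> real \<Rightarrow> real" where
  "periodized_bernoulli k u =
     (if k = 1 \<and> u \<in> \<int> then 0 else bernoulli_poly k (frac u))"

text \<open>
  Tuples \<open>(a\<^sub>1, \<dots>, a\<^sub>n)\<close> are functions on \<open>nat\<close> of which only the values on \<open>{1..n}\<close> are used; the
  omission of the \<open>k\<close>-th entry is rendered by the index set \<open>{1..n} - {k}\<close>.
  Each factor below depends only on \<open>h\<close> modulo \<open>a k\<close> (shifting \<open>h\<close> by \<open>a k\<close> shifts the argument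
  by the integer \<open>a i\<close>), so \<open>{0..<a k}\<close> serves as the complete residue system.
\<close>

definition bernoulli_dedekind_sum ::
  "nat \<Rightarrow> (nat \<Rightarrow> nat) \<Rightarrow> (nat \<Rightarrow> real) \<Rightarrow> nat \<Rightarrow> (nat \<Rightarrow> nat) \<Rightarrow> real" where
  "bernoulli_dedekind_sum n a x k p =
     (\<Sum>h = 0..<a k. \<Prod>i\<in>{1..n} - {k}.
        periodized_bernoulli (p i) (real (a i) * ((real h + x k) / real (a k)) - x i))"

definition omitted_exponents :: "nat \<Rightarrow> nat \<Rightarrow> (nat \<Rightarrow> nat) set" where
  "omitted_exponents n k = ({1..n} - {k}) \<rightarrow>\<^sub>E UNIV"

definition Omega_term ::
  "nat \<Rightarrow> (nat \<Rightarrow> nat) \<Rightarrow> (nat \<Rightarrow> real) \<Rightarrow> (nat \<Rightarrow> complex) \<Rightarrow> nat \<Rightarrow> (nat \<Rightarrow> nat) \<Rightarrow> complex" where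
  "Omega_term n a x y k p =
     1 / (\<Prod>i\<in>{1..n} - {k}. fact (p i))
     * of_real (bernoulli_dedekind_sum n a x k p)
     * (\<Prod>i\<in>{1..n} - {k}. (y i / of_nat (a i)) powi (int (p i) - 1))"

text \<open>
  The generating function, evaluated at complex numbers \<open>y i\<close>. Since \<open>infsum\<close> is \<open>0\<close> on families
  that are not summable, it has to be accompanied by \<open>Omega_summable\<close>.
\<close>

definition Omega ::
  "nat \<Rightarrow> (nat \<Rightarrow> nat) \<Rightarrow> (nat \<Rightarrow> real) \<Rightarrow> (nat \<Rightarrow> complex) \<Rightarrow> nat \<Rightarrow> complex" where
  "Omega n a x y k = (\<Sum>\<^sub>\<infinity>p\<in>omitted_exponents n k. Omega_term n a x y k p)"

definition Omega_summable ::
  "nat \<Rightarrow> (nat \<Rightarrow> nat) \<Rightarrow> (nat \<Rightarrow> real) \<Rightarrow> (nat \<Rightarrow> complex) \<Rightarrow> nat \<Rightarrow> bool" where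
  "Omega_summable n a x y k \<longleftrightarrow> Omega_term n a x y k summable_on omitted_exponents n k"

text \<open>
  The part of the generating function that is homogeneous of total degree \<open>d\<close> in the variables
  \<open>y i\<close>. It is a finite sum, as only finitely many exponent tuples have a given total degree.
  A relation between formal generating functions amounts to the same relation between their
  homogeneous parts for every \<open>d\<close>; these parts are Laurent polynomials in the variables, so such a
  relation under the constraint \<open>y\<^sub>1 + \<dots> + y\<^sub>n = 0\<close> holds formally iff it holds at all nonzero
  complex values subject to that constraint.
\<close>

definition Omega_homogeneous ::
  "nat \<Rightarrow> (nat \<Rightarrow> nat) \<Rightarrow> (nat \<Rightarrow> real) \<Rightarrow> (nat \<Rightarrow> complex) \<Rightarrow> nat \<Rightarrow> int \<Rightarrow> complex" where
  "Omega_homogeneous n a x y k d =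
     (\<Sum>p\<in>{p \<in> omitted_exponents n k. (\<Sum>i\<in>{1..n} - {k}. int (p i) - 1) = d}.
        Omega_term n a x y k p)"

end

theory Submission
  imports Defs "HOL-Complex_Analysis.Cauchy_Integral_Formula"
begin

text \<open>
  Put \<open>z\<^sub>i = y\<^sub>i / a\<^sub>i\<close>, so that \<open>a\<^sub>1 z\<^sub>1 + \<dots> + a\<^sub>n z\<^sub>n = 0\<close>. Since \<open>\<Sum>p. B\<^sub>p(u) z\<^sup>p\<^sup>-\<^sup>1 / p!\<close> is
  \<open>exp (u z) / (exp z - 1)\<close>, the sum over all exponents in \<open>\<Omega>\<^sub>k\<close> factorizes into
  \<open>\<Sum>h mod a\<^sub>k. \<Prod>i\<noteq>k. exp (frac (a\<^sub>i t - x\<^sub>i) z\<^sub>i) / (exp z\<^sub>i - 1)\<close> with \<open>t = (h + x\<^sub>k) / a\<^sub>k\<close>. After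
  multiplication by \<open>\<Prod>i. exp z\<^sub>i - 1\<close>, the theorem says that the numbers
  \<open>(exp z\<^sub>k - 1) * (\<Prod>i\<noteq>k. exp (frac (a\<^sub>i t - x\<^sub>i) z\<^sub>i))\<close>, taken over all \<open>k\<close> and \<open>h\<close>, add up to zero.

  Up to sign, these numbers are the jumps of a single function on the circle,
  \<open>g(t) = (\<Prod>i. exp (frac (a\<^sub>i t - x\<^sub>i) z\<^sub>i))\<close>. Where no \<open>a\<^sub>i t - x\<^sub>i\<close> is an integer, the exponent of
  \<open>g\<close> has slope \<open>\<Sum>i. a\<^sub>i z\<^sub>i = 0\<close>, so \<open>g\<close> is a step function. It can jump only where some
  \<open>a\<^sub>k t - x\<^sub>k\<close> is an integer, that is, at the points \<open>(h + x\<^sub>k) / a\<^sub>k\<close> modulo 1. By the hypothesis on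
  the \<open>x\<^sub>i\<close> only the \<open>k\<close>-th factor is discontinuous there, and it falls back from \<open>exp z\<^sub>k\<close> to \<open>1\<close>. Finally
  \<open>g\<close> has period 1, so its jumps over one period cancel (\<open>sum_jumps_exponential\<close>).

  The cancellation is carried out for power series in an auxiliary variable \<open>X\<close> that marks the
  total degree: each \<open>y\<^sub>i\<close> is replaced by \<open>y\<^sub>i X\<close>, and \<open>exp c\<close> by the series of \<open>exp (c X)\<close>. The
  coefficients are then the homogeneous parts of the generating functions, and no question of
  convergence or of zeros of \<open>exp z\<^sub>i - 1\<close> arises (\<open>sum_Omega_fps_eq_0\<close>). For
  \<open>\<bar>y\<^sub>i\<bar> < 2 \<pi> a\<^sub>i\<close> the generating functions converge absolutely, because the nonzero zeros of
  \<open>exp z - 1\<close> nearest to the origin have modulus \<open>2 \<pi>\<close>; summing by total degree then transfers the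
  homogeneous relations to the values \<open>\<Omega>\<^sub>k\<close>.
\<close>

section \<open>The generating series of the Bernoulli polynomials\<close>

text \<open>
  Cross-multiplied form of the defining quotient \<open>exp (u z) / (exp z - 1)\<close>. It leaves the Laurent
  series behind: \<open>exp z - 1\<close> is \<open>z\<close> times a power series with invertible constant term, so the quotient
  has at most a simple pole.
\<close>

lemma bernoulli_poly_fps:
  "Abs_fps (\<lambda>k. bernoulli_poly k u / fact k) * (fps_exp 1 - 1) = fps_X * fps_exp u"
proof -
  define Q where "Q = fps_shift 1 (fps_exp (1::real) - 1)"
  define R where "R = fps_exp u * inverse Q"
  have Q0: "fps_nth Q 0 \<noteq> 0" by (simp add: Q_def)
  have XQ: "fps_exp (1::real) - 1 = fps_X * Q"
    unfolding Q_def by (rule fps_ext) (auto simp: fps_X_mult_nth)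
  have RQ: "fps_exp u = R * Q"
    using Q0 by (simp add: R_def mult.assoc inverse_mult_eq_1)
  have "fps_to_fls (fps_exp (1::real)) - 1 = fls_X * fps_to_fls Q"
    by (metis XQ fls_times_fps_to_fls fps_X_to_fls fps_one_to_fls fps_to_fls_minus)
  moreover have "fps_to_fls Q \<noteq> 0" using Q0 by auto
  ultimately have "fps_to_fls (fps_exp u) / (fps_to_fls (fps_exp 1) - 1) = fls_X_inv * fps_to_fls R"
    by (simp add: RQ fls_times_fps_to_fls divide_inverse fls_inverse_X mult_ac del: fps_to_fls_eq_0_iff)
  hence "bernoulli_poly k u = fact k * fps_nth R k" for k
    by (simp add: bernoulli_poly_def fls_X_inv_times_conv_shift)
  hence "Abs_fps (\<lambda>k. bernoulli_poly k u / fact k) = R"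
    by (simp add: fps_eq_iff)
  thus ?thesis by (simp add: XQ RQ)
qed

lemma bernoulli_poly_fps_complex:
  "Abs_fps (\<lambda>k. complex_of_real (bernoulli_poly k u / fact k)) * (fps_exp 1 - 1) =
     fps_X * fps_exp (complex_of_real u)"
proof (rule fps_ext)
  fix m
  have "complex_of_real (fps_nth (Abs_fps (\<lambda>k. bernoulli_poly k u / fact k) * (fps_exp 1 - 1)) m)
      = complex_of_real (fps_nth (fps_X * fps_exp u) m)"
    by (simp only: bernoulli_poly_fps)
  moreover have "complex_of_real (fps_nth (fps_exp 1 - 1) j) = fps_nth (fps_exp 1 - 1) j" for j
    by simp
  moreover have "complex_of_real (fps_nth (fps_X * fps_exp u) m) = fps_nth (fps_X * fps_exp (of_real u)) m"
    by simp
  ultimately show "fps_nth (Abs_fps (\<lambda>k. complex_of_real (bernoulli_poly k u / fact k)) * (fps_exp 1 - 1)) m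
      = fps_nth (fps_X * fps_exp (complex_of_real u)) m"
    by (simp only: fps_mult_nth fps_nth_Abs_fps of_real_sum of_real_mult)
qed

text \<open>
  The series is \<open>z exp (u z) / (exp z - 1)\<close>: the simple zeros at the origin cancel, and the remaining
  zeros of the denominator are the nonzero multiples of \<open>2 \<pi> \<i>\<close>.
\<close>

lemma fps_conv_radius_bernoulli_poly:
  "fps_conv_radius (Abs_fps (\<lambda>k. complex_of_real (bernoulli_poly k u / fact k))) \<ge> 2 * pi"
proof -
  let ?D = "fps_exp 1 - 1 :: complex fps"
  let ?N = "fps_X * fps_exp (complex_of_real u)"
  have "fps_nth ?D 1 \<noteq> 0" by simp
  hence D0: "?D \<noteq> 0" by force
  have subD: "subdegree ?D = 1" by (rule subdegreeI) auto
  have subN: "subdegree ?N = 1" by (rule subdegreeI) (auto simp: fps_X_mult_nth)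
  have radD: "fps_conv_radius ?D = \<infinity>"
    using fps_conv_radius_diff[of "fps_exp 1 :: complex fps" 1] by simp
  have radN: "fps_conv_radius ?N = \<infinity>"
    using fps_conv_radius_mult[of "fps_X" "fps_exp (complex_of_real u)"] by simp
  have nz: "eval_fps ?D z \<noteq> 0" if z: "z \<in> eball 0 (ereal (2 * pi))" "z \<noteq> 0" for z
  proof
    assume "eval_fps ?D z = 0"
    hence "exp z = 1" by (simp add: eval_fps_diff)
    then obtain m :: int where "Re z = 0" and m: "Im z = of_int (2 * m) * pi"
      by (auto simp: exp_eq_1)
    hence "cmod z = \<bar>of_int (2 * m) * pi\<bar>" by (simp add: cmod_def)
    moreover have "m \<noteq> 0" using \<open>z \<noteq> 0\<close> \<open>Re z = 0\<close> m by (auto simp: complex_eq_iff)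
    hence "\<bar>of_int (2 * m) :: real\<bar> \<ge> 2" by linarith
    hence "\<bar>of_int (2 * m) * pi\<bar> \<ge> 2 * pi" by (simp add: abs_mult)
    ultimately show False using z by (simp add: dist_norm)
  qed
  have "Abs_fps (\<lambda>k. complex_of_real (bernoulli_poly k u / fact k)) = ?N / ?D"
    using D0 by (simp flip: bernoulli_poly_fps_complex)
  moreover have "fps_conv_radius (?N / ?D) \<ge> Min {ereal (2 * pi), fps_conv_radius ?N, fps_conv_radius ?D}"
    by (rule fps_conv_radius_divide) (use nz in \<open>simp_all only: subD subN radD radN, auto\<close>)
  ultimately show ?thesis by (simp add: radD radN)
qed

text \<open>
  For \<open>z \<noteq> 0\<close> this is \<open>X exp (u z X) / (exp (z X) - 1)\<close>, the factor \<open>X\<close> removing the pole: what the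
  variable \<open>y\<^sub>i\<close>, with \<open>z = y\<^sub>i / a\<^sub>i\<close>, contributes to the generating function. The coefficient of
  \<open>X\<^sup>k\<close> belongs to degree \<open>k - 1\<close>, so a product of \<open>m\<close> such series is shifted by \<open>m\<close>.
\<close>

definition bernoulli_fps :: "real \<Rightarrow> complex \<Rightarrow> complex fps" where
  "bernoulli_fps u z = Abs_fps (\<lambda>k. of_real (bernoulli_poly k u / fact k) * z powi (int k - 1))"

lemma bernoulli_fps_nth:
  "z \<noteq> 0 \<Longrightarrow> fps_nth (bernoulli_fps u z) k = of_real (bernoulli_poly k u / fact k) * z ^ k / z"
  by (simp add: bernoulli_fps_def power_int_diff)

lemma bernoulli_fps_mult:
  assumes "z \<noteq> 0"
  shows "bernoulli_fps u z * (fps_exp z - 1) = fps_X * fps_exp (of_real u * z)"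
proof -
  let ?C = "Abs_fps (\<lambda>k. complex_of_real (bernoulli_poly k u / fact k))"
  let ?l = "fps_const z * fps_X"
  have "bernoulli_fps u z = fps_const (1 / z) * (?C oo ?l)"
    by (rule fps_ext) (simp add: bernoulli_fps_nth assms, simp add: field_simps)
  moreover have "(?C oo ?l) * (fps_exp z - 1) = (?C * (fps_exp 1 - 1)) oo ?l"
    by (simp add: fps_compose_mult_distrib fps_compose_sub_distrib fps_exp_compose_linear)
  moreover have "\<dots> = ?l * fps_exp (of_real u * z)"
    unfolding bernoulli_poly_fps_complex
    by (simp add: fps_compose_mult_distrib fps_exp_compose_linear mult.commute[of z])
  ultimately have "bernoulli_fps u z * (fps_exp z - 1) = fps_const (1 / z) * (?l * fps_exp (of_real u * z))"
    by (simp only: mult.assoc)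
  also have "\<dots> = fps_X * fps_exp (of_real u * z)"
    using assms by (simp add: fps_eq_iff mult.assoc)
  finally show ?thesis .
qed

lemma bernoulli_fps_abs_summable:
  assumes "z \<noteq> 0" "cmod z < 2 * pi"
  shows "summable (\<lambda>k. norm (fps_nth (bernoulli_fps u z) k))"
proof -
  have "ereal (norm z) < fps_conv_radius (Abs_fps (\<lambda>k. complex_of_real (bernoulli_poly k u / fact k)))"
    using assms(2) by (intro less_le_trans[OF _ fps_conv_radius_bernoulli_poly]) simp
  hence "summable (\<lambda>k. norm (complex_of_real (bernoulli_poly k u / fact k) * z ^ k))"
    using norm_summable_fps by fastforce
  hence "summable (\<lambda>k. norm (complex_of_real (bernoulli_poly k u / fact k) * z ^ k) / cmod z)"
    by (rule summable_divide)
  thus ?thesis using assms(1) by (simp add: bernoulli_fps_nth norm_divide norm_mult)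
qed

section \<open>Products of families indexed by tuples\<close>

lemma fps_nth_prod_PiE:
  assumes "finite S"
  shows "fps_nth (\<Prod>i\<in>S. f i) m =
    (\<Sum>p\<in>{p \<in> S \<rightarrow>\<^sub>E UNIV. (\<Sum>i\<in>S. p i) = m}. \<Prod>i\<in>S. fps_nth (f i :: 'a :: comm_semiring_1 fps) (p i))"
  using assms
proof (induction S arbitrary: m)
  case empty
  have "{p. p = (\<lambda>x. undefined) \<and> 0 = m} = (if m = 0 then {\<lambda>x. undefined :: nat} else {})"
    by auto
  thus ?case by auto
next
  case (insert b S)
  let ?P = "\<lambda>S m. {p \<in> S \<rightarrow>\<^sub>E (UNIV :: nat set). (\<Sum>i\<in>S. p i) = m}"
  have other: "(\<Prod>i\<in>S. fps_nth (f i) (if i = b then j else p i)) = (\<Prod>i\<in>S. fps_nth (f i) (p i))" for p j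
    using insert.hyps by (intro prod.cong) auto
  have othersum: "(\<Sum>i\<in>S. if i = b then j else p i) = (\<Sum>i\<in>S. p i)" for p :: "_ \<Rightarrow> nat" and j
    using insert.hyps by (intro sum.cong) auto
  have "fps_nth (\<Prod>i\<in>insert b S. f i) m =
      (\<Sum>j=0..m. \<Sum>p\<in>?P S (m - j). fps_nth (f b) j * (\<Prod>i\<in>S. fps_nth (f i) (p i)))"
    using insert by (simp add: fps_mult_nth sum_distrib_left)
  also have "\<dots> = (\<Sum>(j, p)\<in>Sigma {0..m} (\<lambda>j. ?P S (m - j)).
                      fps_nth (f b) j * (\<Prod>i\<in>S. fps_nth (f i) (p i)))"
  proof (rule sum.Sigma)
    show "\<forall>j\<in>{0..m}. finite (?P S (m - j))"
    proof
      fix j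
      have "?P S (m - j) \<subseteq> S \<rightarrow>\<^sub>E {..m - j}"
        using insert.hyps(1) by (auto simp: PiE_iff extensional_def intro: order.trans[OF member_le_sum eq_refl])
      thus "finite (?P S (m - j))"
        by (rule finite_subset) (use insert.hyps(1) in \<open>auto intro: finite_PiE\<close>)
    qed
  qed auto
  also have "\<dots> = (\<Sum>p\<in>?P (insert b S) m. \<Prod>i\<in>insert b S. fps_nth (f i) (p i))"
    by (rule sum.reindex_bij_witness[of _ "\<lambda>p. (p b, p(b := undefined))" "\<lambda>(j, p). p(b := j)"])
       (use insert.hyps in \<open>auto simp: PiE_iff extensional_def other othersum\<close>)
  finally show ?case .
qed

text \<open>
  A finite set of tuples lies in the box spanned by its projections, and over a box the sum of the
  products is the product of the sums; so the product of the total sums is a common bound.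
\<close>

lemma abs_summable_on_prod_PiE:
  fixes f :: "'i \<Rightarrow> 'b \<Rightarrow> 'c :: {real_normed_field, banach}"
  assumes "finite S" and "\<And>i. i \<in> S \<Longrightarrow> (\<lambda>b. norm (f i b)) summable_on B i"
  shows "(\<lambda>p. norm (\<Prod>i\<in>S. f i (p i))) summable_on (Pi\<^sub>E S B)"
proof (rule nonneg_bdd_above_summable_on)
  show "bdd_above (sum (\<lambda>p. norm (\<Prod>i\<in>S. f i (p i))) ` {F. F \<subseteq> Pi\<^sub>E S B \<and> finite F})"
  proof (rule bdd_aboveI2)
    fix F assume F: "F \<in> {F. F \<subseteq> Pi\<^sub>E S B \<and> finite F}"
    let ?B = "\<lambda>i. (\<lambda>p. p i) ` F"
    have "(\<Sum>p\<in>F. norm (\<Prod>i\<in>S. f i (p i))) \<le> (\<Sum>p\<in>Pi\<^sub>E S ?B. norm (\<Prod>i\<in>S. f i (p i)))"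
      using F assms(1) by (intro sum_mono2) (auto simp: PiE_iff intro!: finite_PiE)
    also have "\<dots> = (\<Prod>i\<in>S. \<Sum>b\<in>?B i. norm (f i b))"
      using F assms(1) by (subst prod_sum_PiE) (auto simp: prod_norm)
    also have "\<dots> \<le> (\<Prod>i\<in>S. \<Sum>\<^sub>\<infinity>b\<in>B i. norm (f i b))"
      using F assms(2) by (intro prod_mono conjI sum_nonneg finite_sum_le_infsum) (auto simp: PiE_iff)
    finally show "(\<Sum>p\<in>F. norm (\<Prod>i\<in>S. f i (p i))) \<le> (\<Prod>i\<in>S. \<Sum>\<^sub>\<infinity>b\<in>B i. norm (f i b))" .
  qed
qed simp

lemma has_sum_finite_sum:
  fixes f :: "'i \<Rightarrow> 'b \<Rightarrow> 'c :: topological_comm_monoid_add"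
  assumes "finite I" and "\<And>i. i \<in> I \<Longrightarrow> (f i has_sum s i) B"
  shows "((\<lambda>b. \<Sum>i\<in>I. f i b) has_sum (\<Sum>i\<in>I. s i)) B"
  using assms by induction (auto intro: has_sum_add)

section \<open>Jumps of a periodic step function\<close>

text \<open>
  The left-continuous fractional part: its values lie in \<open>{0<..1}\<close>, and at every point it is the left
  limit of \<^term>\<open>frac\<close>.
\<close>

definition upper_frac :: "real \<Rightarrow> real" where
  "upper_frac u = u - of_int \<lceil>u\<rceil> + 1"

lemma upper_frac_Ints: "u \<in> \<int> \<Longrightarrow> upper_frac u = 1"
  by (auto simp: upper_frac_def elim: Ints_cases)

lemma upper_frac_not_Ints: "u \<notin> \<int> \<Longrightarrow> upper_frac u = frac u"
  by (simp add: upper_frac_def frac_def ceiling_altdef) (metis Ints_of_int)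

lemma upper_frac_add_int: "upper_frac (u + of_int m) = upper_frac u"
  by (simp add: upper_frac_def)

lemma frac_add_int: "frac (u + of_int m) = frac (u :: real)"
  by (simp add: frac_def)

text \<open>
  Over an interval without interior integers the fractional part grows with slope 1 from its value at the
  left end to its left limit at the right end.
\<close>

lemma upper_frac_minus_frac:
  assumes "u < v" and "\<And>w. u < w \<Longrightarrow> w < v \<Longrightarrow> w \<notin> \<int>"
  shows "upper_frac v - frac u = v - u"
proof -
  have "\<not> (u < of_int (\<lceil>v\<rceil> - 1))"
    using assms(2)[of "of_int (\<lceil>v\<rceil> - 1)"] by (metis Ints_of_int ceiling_correct of_int_diff of_int_1)
  hence "\<lceil>v\<rceil> - 1 \<le> \<lfloor>u\<rfloor>" by (simp add: le_floor_iff)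
  moreover have "\<lfloor>u\<rfloor> < \<lceil>v\<rceil>" using assms(1) by linarith
  ultimately have "\<lceil>v\<rceil> = \<lfloor>u\<rfloor> + 1" by linarith
  thus ?thesis by (simp add: upper_frac_def frac_def)
qed

text \<open>
  Here \<open>gm t\<close> plays the part of the left limit of \<open>g\<close> at \<open>t\<close>. The last hypothesis expresses that \<open>g\<close>
  is constant between consecutive points of \<open>P\<close>, so the sum telescopes. Formulating it with \<open>gm\<close> rather
  than with limits keeps the lemma free of topology and valid in any abelian group.
\<close>

lemma sum_jumps_step_function:
  fixes g gm :: "real \<Rightarrow> 'a :: ab_group_add"
  assumes "finite P" "P \<subseteq> {c..<d}" "c \<le> d"
    and "\<And>t. t \<in> {c..<d} \<Longrightarrow> t \<notin> P \<Longrightarrow> g t = gm t"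
    and "\<And>s t. c \<le> s \<Longrightarrow> s < t \<Longrightarrow> t \<le> d \<Longrightarrow> P \<inter> {s<..<t} = {} \<Longrightarrow> g s = gm t"
  shows "(\<Sum>t\<in>P. g t - gm t) = gm d - gm c"
  using assms
proof (induction P arbitrary: d rule: finite_linorder_max_induct)
  case empty
  show ?case
  proof (cases "c = d")
    case False
    hence "g c = gm d" "g c = gm c"
      using empty.prems(2) by (intro empty.prems(4), simp_all) (intro empty.prems(3), simp_all)
    thus ?thesis by simp
  qed simp
next
  case (insert b A)
  have "(\<Sum>t\<in>A. g t - gm t) = gm b - gm c"
  proof (rule insert.IH)
    show "A \<subseteq> {c..<b}" "c \<le> b" using insert.prems(1) insert.hyps by auto
    show "g t = gm t" if "t \<in> {c..<b}" "t \<notin> A" for t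
      using that insert.prems(1) by (intro insert.prems(3)) auto
    show "g s = gm t" if "c \<le> s" "s < t" "t \<le> b" "A \<inter> {s<..<t} = {}" for s t
      using that insert.prems(1) by (intro insert.prems(4)) auto
  qed
  \<comment> \<open>\<open>b\<close> is the last jump point, so \<open>g\<close> stays constant from \<open>b\<close> up to the left limit at \<open>d\<close>.\<close>
  moreover have "g b = gm d"
    using insert.prems(1) insert.hyps by (intro insert.prems(4)) auto
  moreover have "b \<notin> A" using insert.hyps by auto
  ultimately show ?case using insert.hyps by simp
qed

text \<open>
  A residue system modulo \<open>a\<close> enumerates the discontinuities on the circle of \<open>frac (a t - x)\<close>. The
  shift \<open>x\<close> is an arbitrary real, so the points \<open>(h + x) / a\<close> have to be reduced modulo 1 to lie in one
  common period for all indices.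
\<close>

lemma bij_betw_jump_points:
  assumes "a \<ge> 1"
  shows "bij_betw (\<lambda>h. frac ((real h + x) / real a)) {0..<a} {t \<in> {0..<1}. real a * t - x \<in> \<int>}"
proof (rule bij_betwI')
  have a: "real a > 0" using assms by simp
  show "(frac ((real h + x) / real a) = frac ((real h' + x) / real a)) = (h = h')"
    if "h \<in> {0..<a}" "h' \<in> {0..<a}" for h h'
  proof
    assume "frac ((real h + x) / real a) = frac ((real h' + x) / real a)"
    moreover define m where "m = \<lfloor>(real h + x) / real a\<rfloor> - \<lfloor>(real h' + x) / real a\<rfloor>"
    ultimately have "(real h + x) / real a - (real h' + x) / real a = of_int m"
      by (simp add: frac_def)
    hence "real h - real h' = of_int m * real a"
      using a by (simp add: diff_divide_distrib[symmetric] divide_eq_eq)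
    hence *: "int h - int h' = m * int a"
      using of_int_eq_iff[where 'a = real, of "int h - int h'" "m * int a"] by simp
    hence "int h = int h' + m * int a" by simp
    hence "int h mod int a = int h' mod int a" by simp
    thus "h = h'" using that by simp
  qed simp
  show "frac ((real h + x) / real a) \<in> {t \<in> {0..<1}. real a * t - x \<in> \<int>}" for h
  proof -
    have "real a * frac ((real h + x) / real a) - x = of_int (int h - int a * \<lfloor>(real h + x) / real a\<rfloor>)"
      using a by (simp add: frac_def field_simps)
    thus ?thesis by (simp add: frac_ge_0 frac_lt_1 del: of_int_diff of_int_mult)
  qed
  show "\<exists>h\<in>{0..<a}. t = frac ((real h + x) / real a)"
    if "t \<in> {t \<in> {0..<1}. real a * t - x \<in> \<int>}" for t
  proof -
    from that obtain m :: int where m: "real a * t - x = of_int m"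
      by (auto elim: Ints_cases)
    define h where "h = nat (m mod int a)"
    have h: "int h = m mod int a" using assms by (simp add: h_def)
    hence "m = int h + int a * (m div int a)" by simp
    hence "real_of_int m = real_of_int (int h + int a * (m div int a))"
      by (rule arg_cong)
    hence "real_of_int m = real h + real a * of_int (m div int a)"
      by (simp only: of_int_add of_int_mult of_int_of_nat_eq)
    hence "(real h + x) / real a + of_int (m div int a) = t"
      using m a by (simp add: field_simps)
    hence "frac ((real h + x) / real a) = frac t"
      by (metis frac_add_int)
    moreover have "frac t = t" using that by (simp add: frac_eq)
    moreover have "int h < int a" unfolding h by (rule pos_mod_bound) (use assms in simp)
    ultimately show ?thesis by auto
  qed
qed

text \<open>
  The core of the reciprocity law: the summands are the jumps, with reversed sign, of the periodic step
  function \<open>g(t) = (\<Prod>i\<in>I. exp (frac (a\<^sub>i t - x\<^sub>i) z\<^sub>i))\<close>. The hypothesis \<open>bal\<close> makes \<open>g\<close> locally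
  constant and periodic; \<open>gen\<close> makes at most one factor jump at each point.
\<close>

lemma sum_jumps_exponential:
  fixes z :: "nat \<Rightarrow> complex"
  assumes a: "\<And>i. i \<in> I \<Longrightarrow> a i \<ge> 1" and "finite I"
    and bal: "(\<Sum>i\<in>I. of_nat (a i) * z i) = 0"
    and gen: "\<And>t i j. i \<in> I \<Longrightarrow> j \<in> I \<Longrightarrow> i \<noteq> j \<Longrightarrow>
                real (a i) * t - x i \<in> \<int> \<Longrightarrow> real (a j) * t - x j \<notin> \<int>"
  shows "(\<Sum>k\<in>I. \<Sum>h=0..<a k. (fps_exp (z k) - 1) * (\<Prod>i\<in>I - {k}.
           fps_exp (of_real (frac (real (a i) * ((real h + x k) / real (a k)) - x i)) * z i))) = 0"
proof -
  let ?e = "\<lambda>c. fps_exp c :: complex fps"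
  define g where "g t = (\<Prod>i\<in>I. ?e (of_real (frac (real (a i) * t - x i)) * z i))" for t
  define gm where "gm t = (\<Prod>i\<in>I. ?e (of_real (upper_frac (real (a i) * t - x i)) * z i))" for t
  define J where "J k = {t \<in> {0..<1}. real (a k) * t - x k \<in> \<int>}" for k
  define w where "w k t = (?e (z k) - 1) *
     (\<Prod>i\<in>I - {k}. ?e (of_real (frac (real (a i) * t - x i)) * z i))" for k t
  have bij: "bij_betw (\<lambda>h. frac ((real h + x k) / real (a k))) {0..<a k} (J k)" if "k \<in> I" for k
    unfolding J_def by (rule bij_betw_jump_points) (use a that in simp)
  have finJ: "finite (J k)" if "k \<in> I" for k
    using bij_betw_finite[OF bij[OF that]] by simp
  have prod_e: "(\<Prod>i\<in>I. ?e (f i)) = ?e (\<Sum>i\<in>I. f i)" for f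
    using \<open>finite I\<close> by (induction) (simp_all add: fps_exp_add_mult)
  \<comment> \<open>The \<open>k\<close>-th factor has left limit \<open>exp z\<^sub>k\<close> and value 1; the other factors are continuous at \<open>t\<close>.\<close>
  have jump: "w k t = gm t - g t" if k: "k \<in> I" and t: "t \<in> J k" for k t
  proof -
    have int: "real (a k) * t - x k \<in> \<int>" using t by (simp add: J_def)
    have "gm t = ?e (z k) * (\<Prod>i\<in>I - {k}. ?e (of_real (upper_frac (real (a i) * t - x i)) * z i))"
      unfolding gm_def using k \<open>finite I\<close> by (subst prod.remove[of _ k]) (auto simp: upper_frac_Ints[OF int])
    also have "(\<Prod>i\<in>I - {k}. ?e (of_real (upper_frac (real (a i) * t - x i)) * z i)) =
        (\<Prod>i\<in>I - {k}. ?e (of_real (frac (real (a i) * t - x i)) * z i))"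
      by (intro prod.cong refl) (use gen[OF k _ _ int] upper_frac_not_Ints in auto)
    finally have "gm t = ?e (z k) * (\<Prod>i\<in>I - {k}. ?e (of_real (frac (real (a i) * t - x i)) * z i))" .
    moreover have "g t = (\<Prod>i\<in>I - {k}. ?e (of_real (frac (real (a i) * t - x i)) * z i))"
      unfolding g_def using k \<open>finite I\<close> int by (subst prod.remove[of _ k]) (auto simp: frac_eq_0_iff)
    ultimately show ?thesis by (simp add: w_def algebra_simps)
  qed
  have "(\<Sum>t\<in>(\<Union>k\<in>I. J k). g t - gm t) = gm 1 - gm 0"
  proof (rule sum_jumps_step_function)
    show "finite (\<Union>k\<in>I. J k)" using \<open>finite I\<close> finJ by auto
    show "(\<Union>k\<in>I. J k) \<subseteq> {0..<1}" by (auto simp: J_def)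
    show "g t = gm t" if "t \<in> {0..<1}" "t \<notin> (\<Union>k\<in>I. J k)" for t
      unfolding g_def gm_def using that by (intro prod.cong refl) (auto simp: J_def upper_frac_not_Ints)
    show "g s = gm t" if st: "0 \<le> s" "s < t" "t \<le> 1" and empty: "(\<Union>k\<in>I. J k) \<inter> {s<..<t} = {}" for s t
    proof -
      have diff: "upper_frac (real (a i) * t - x i) - frac (real (a i) * s - x i) = real (a i) * (t - s)"
        if i: "i \<in> I" for i
      proof -
        have ai: "real (a i) > 0" using a[OF i] by simp
        have "upper_frac (real (a i) * t - x i) - frac (real (a i) * s - x i)
            = (real (a i) * t - x i) - (real (a i) * s - x i)"
        proof (rule upper_frac_minus_frac)
          show "real (a i) * s - x i < real (a i) * t - x i" using st ai by simp
          fix v assume v: "real (a i) * s - x i < v" "v < real (a i) * t - x i"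
          define r where "r = (v + x i) / real (a i)"
          have r: "s < r" "r < t" using v ai by (simp_all add: r_def field_simps)
          hence "r \<notin> J i" using empty i by auto
          moreover have "real (a i) * r - x i = v" using ai by (simp add: r_def)
          ultimately show "v \<notin> \<int>" using r st by (auto simp: J_def)
        qed
        thus ?thesis by (simp add: algebra_simps)
      qed
      have "(\<Sum>i\<in>I. of_real (upper_frac (real (a i) * t - x i)) * z i)
          - (\<Sum>i\<in>I. of_real (frac (real (a i) * s - x i)) * z i)
          = (\<Sum>i\<in>I. of_real (real (a i) * (t - s)) * z i)"
        unfolding sum_subtractf[symmetric]
        by (intro sum.cong refl) (simp add: left_diff_distrib[symmetric] of_real_diff[symmetric] diff del: of_real_diff of_real_mult)
      \<comment> \<open>All fractional parts grow linearly, and the growth of the exponent cancels by \<open>bal\<close>.\<close>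
      also have "\<dots> = of_real (t - s) * (\<Sum>i\<in>I. of_nat (a i) * z i)"
        by (simp add: sum_distrib_left mult_ac)
      finally show ?thesis by (simp add: g_def gm_def prod_e bal)
    qed
  qed auto
  also have "gm 1 = gm 0"
    unfolding gm_def using upper_frac_add_int[of "- x _" "int (a _)"] by (simp add: add.commute)
  finally have tele: "(\<Sum>t\<in>(\<Union>k\<in>I. J k). gm t - g t) = 0"
    by (simp add: sum_subtractf)
  have period: "w k (frac r) = w k r" for k r
  proof -
    have "frac (real (a i) * r - x i) = frac (real (a i) * frac r - x i)" for i
      using frac_add_int[of "real (a i) * frac r - x i" "int (a i) * \<lfloor>r\<rfloor>"]
      by (simp add: frac_def algebra_simps)
    thus ?thesis by (simp add: w_def)
  qed
  have "(\<Sum>h=0..<a k. w k ((real h + x k) / real (a k))) = (\<Sum>t\<in>J k. gm t - g t)" if k: "k \<in> I" for k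
  proof -
    have "(\<Sum>h=0..<a k. w k ((real h + x k) / real (a k))) = (\<Sum>t\<in>J k. w k t)"
      using sum.reindex_bij_betw[OF bij[OF k], of "w k"] by (simp add: period)
    thus ?thesis using jump[OF k] by simp
  qed
  hence "(\<Sum>k\<in>I. \<Sum>h=0..<a k. w k ((real h + x k) / real (a k))) = (\<Sum>k\<in>I. \<Sum>t\<in>J k. gm t - g t)"
    by simp
  also have "\<dots> = (\<Sum>t\<in>(\<Union>k\<in>I. J k). gm t - g t)"
    using \<open>finite I\<close> finJ gen by (intro sum.UNION_disjoint[symmetric]) (auto simp: J_def)
  finally show ?thesis using tele by (simp add: w_def)
qed

section \<open>Generating functions of Bernoulli--Dedekind sums\<close>

text \<open>
  Clearing denominators in a product that omits the index \<open>k\<close>: the denominators \<open>c i\<close> of the factors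
  \<open>f i = q * g i / c i\<close> cancel, and \<open>c k\<close> is left over.
\<close>

lemma prod_mult_prod_omit:
  fixes f g c :: "'i \<Rightarrow> 'a :: comm_ring_1"
  assumes "finite I" "k \<in> I" and "\<And>i. i \<in> I - {k} \<Longrightarrow> f i * c i = q * g i"
  shows "(\<Prod>i\<in>I. c i) * (\<Prod>i\<in>I - {k}. f i) = q ^ (card I - 1) * (c k * (\<Prod>i\<in>I - {k}. g i))"
proof -
  have "(\<Prod>i\<in>I. c i) * (\<Prod>i\<in>I - {k}. f i) = c k * (\<Prod>i\<in>I - {k}. f i * c i)"
    using assms(1,2) by (subst prod.remove[of _ k]) (auto simp: prod.distrib mult_ac)
  also have "(\<Prod>i\<in>I - {k}. f i * c i) = (\<Prod>i\<in>I - {k}. q * g i)"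
    by (rule prod.cong) (use assms(3) in auto)
  finally show ?thesis using assms(1,2) by (simp add: prod.distrib mult_ac)
qed

abbreviation dedekind_arg :: "(nat \<Rightarrow> nat) \<Rightarrow> (nat \<Rightarrow> real) \<Rightarrow> nat \<Rightarrow> nat \<Rightarrow> nat \<Rightarrow> real" where
  "dedekind_arg a x k h i \<equiv> real (a i) * ((real h + x k) / real (a k)) - x i"

text \<open>
  For \<open>1 \<le> k \<le> n\<close> and data as in the locale below, the generating function with every
  \<open>y\<^sub>i\<close> replaced by \<open>y\<^sub>i X\<close>, multiplied by \<open>X\<^sup>n\<^sup>-\<^sup>1\<close> to remove the poles. The exponent \<open>n - 1\<close> is the same for all \<open>k\<close>, so the relation between the generating functions
  carries over to these series unchanged.
\<close>

definition Omega_fps ::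
  "nat \<Rightarrow> (nat \<Rightarrow> nat) \<Rightarrow> (nat \<Rightarrow> real) \<Rightarrow> (nat \<Rightarrow> complex) \<Rightarrow> nat \<Rightarrow> complex fps" where
  "Omega_fps n a x y k = (\<Sum>h = 0..<a k. \<Prod>i\<in>{1..n} - {k}.
     bernoulli_fps (frac (dedekind_arg a x k h i)) (y i / of_nat (a i)))"

text \<open>
  The assumption \<open>jumps_distinct\<close> is the hypothesis on the \<open>x\<^sub>i\<close> in the form in which it acts: no point
  of the circle is a discontinuity of two of the functions \<open>frac (a\<^sub>i t - x\<^sub>i)\<close>.
\<close>

locale generic_dedekind_data =
  fixes n :: nat and a :: "nat \<Rightarrow> nat" and x :: "nat \<Rightarrow> real" and y :: "nat \<Rightarrow> complex"
  assumes a_ge_1: "i \<in> {1..n} \<Longrightarrow> a i \<ge> 1"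
    and y_nonzero: "i \<in> {1..n} \<Longrightarrow> y i \<noteq> 0"
    and y_balanced: "(\<Sum>i=1..n. y i) = 0"
    and jumps_distinct: "\<lbrakk>i \<in> {1..n}; j \<in> {1..n}; i \<noteq> j; real (a i) * t - x i \<in> \<int>\<rbrakk>
      \<Longrightarrow> real (a j) * t - x j \<notin> \<int>"
begin

lemma scaled_y_nonzero: "i \<in> {1..n} \<Longrightarrow> y i / of_nat (a i) \<noteq> 0"
  using y_nonzero[of i] a_ge_1[of i] by simp

text \<open>
  Multiplication by the nonzero series \<open>\<Prod>i. exp (z\<^sub>i X) - 1\<close> turns the sum into \<open>X\<^sup>n\<^sup>-\<^sup>1\<close> times the sum
  of jumps in \<open>sum_jumps_exponential\<close>.
\<close>

lemma sum_Omega_fps_eq_0: "(\<Sum>k=1..n. Omega_fps n a x y k) = 0"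
proof -
  define z where "z i = y i / of_nat (a i)" for i
  define r where "r k h i = frac (dedekind_arg a x k h i)" for k h i
  define c where "c = (\<Prod>i\<in>{1..n}. fps_exp (z i) - 1)"
  have z: "z i \<noteq> 0" if "i \<in> {1..n}" for i
    using scaled_y_nonzero[OF that] by (simp add: z_def)
  have "(\<Sum>i\<in>{1..n}. of_nat (a i) * z i) = (\<Sum>i\<in>{1..n}. y i)"
    by (rule sum.cong) (use a_ge_1 in \<open>force simp: z_def\<close>)+
  hence jumps: "(\<Sum>k\<in>{1..n}. \<Sum>h=0..<a k. (fps_exp (z k) - 1) *
           (\<Prod>i\<in>{1..n} - {k}. fps_exp (of_real (r k h i) * z i))) = 0"
    unfolding r_def using a_ge_1 y_balanced jumps_distinct
    by (intro sum_jumps_exponential) simp_all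
  have c_mult: "c * Omega_fps n a x y k = fps_X ^ (n - 1) *
      (\<Sum>h=0..<a k. (fps_exp (z k) - 1) * (\<Prod>i\<in>{1..n} - {k}. fps_exp (of_real (r k h i) * z i)))"
    if k: "k \<in> {1..n}" for k
    unfolding Omega_fps_def c_def z_def[symmetric] r_def[symmetric] sum_distrib_left
    using prod_mult_prod_omit[of "{1..n}" k "\<lambda>i. bernoulli_fps (r k _ i) (z i)"
        "\<lambda>i. fps_exp (z i) - 1" fps_X "\<lambda>i. fps_exp (of_real (r k _ i) * z i)"] k z
    by (intro sum.cong refl) (simp add: bernoulli_fps_mult)
  have "c * (\<Sum>k=1..n. Omega_fps n a x y k) = (\<Sum>k=1..n. c * Omega_fps n a x y k)"
    by (rule sum_distrib_left)
  also have "\<dots> = (\<Sum>k=1..n. fps_X ^ (n - 1) *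
      (\<Sum>h=0..<a k. (fps_exp (z k) - 1) * (\<Prod>i\<in>{1..n} - {k}. fps_exp (of_real (r k h i) * z i))))"
    by (rule sum.cong[OF refl c_mult])
  also have "\<dots> = 0"
    unfolding sum_distrib_left[of "fps_X ^ (n - 1)", symmetric] jumps by simp
  finally have "c * (\<Sum>k=1..n. Omega_fps n a x y k) = 0" .
  moreover have "fps_exp (z i) \<noteq> 1" if "i \<in> {1..n}" for i
  proof
    assume "fps_exp (z i) = 1"
    hence "fps_nth (fps_exp (z i)) 1 = fps_nth 1 1" by simp
    thus False using z[OF that] by simp
  qed
  hence "c \<noteq> 0" by (simp add: c_def)
  ultimately show ?thesis by simp
qed

text \<open>
  At \<open>t = (h + x\<^sub>k) / a\<^sub>k\<close> the function \<open>a\<^sub>k t - x\<^sub>k\<close> is an integer, so by \<open>jumps_distinct\<close> no other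
  \<open>a\<^sub>i t - x\<^sub>i\<close> is; hence the exceptional value of the periodized first Bernoulli polynomial never
  enters, and the term is a product over \<open>i\<close> of coefficients.
\<close>

lemma Omega_term_eq:
  assumes k: "k \<in> {1..n}"
  shows "Omega_term n a x y k p = (\<Sum>h = 0..<a k. \<Prod>i\<in>{1..n} - {k}. fps_nth
     (bernoulli_fps (frac (dedekind_arg a x k h i)) (y i / of_nat (a i))) (p i))"
proof -
  have "periodized_bernoulli j (dedekind_arg a x k h i) =
          bernoulli_poly j (frac (dedekind_arg a x k h i))"
    if "i \<in> {1..n} - {k}" for i j h
  proof -
    have "real (a k) * ((real h + x k) / real (a k)) - x k \<in> \<int>"
    proof -
      have "real (a k) \<noteq> 0" using a_ge_1[OF k] by simp
      thus ?thesis by simp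
    qed
    hence "dedekind_arg a x k h i \<notin> \<int>"
      using jumps_distinct[OF k] that by blast
    thus ?thesis by (simp add: periodized_bernoulli_def)
  qed
  hence "bernoulli_dedekind_sum n a x k p = (\<Sum>h = 0..<a k. \<Prod>i\<in>{1..n} - {k}.
          bernoulli_poly (p i) (frac (dedekind_arg a x k h i)))"
    unfolding bernoulli_dedekind_sum_def by (intro sum.cong prod.cong refl) auto
  thus ?thesis
    by (simp add: Omega_term_def bernoulli_fps_def prod.distrib prod_dividef
        sum_distrib_left sum_distrib_right sum_divide_distrib)
qed

text \<open>
  Total degree \<open>d\<close> corresponds to the exponent \<open>d + (n - 1)\<close> of \<open>X\<close>, as each of the \<open>n - 1\<close> factors
  shifts the degree by one.
\<close>

lemma Omega_homogeneous_eq: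
  assumes k: "k \<in> {1..n}"
  shows "Omega_homogeneous n a x y k d =
    (if d + int (n - 1) \<ge> 0 then fps_nth (Omega_fps n a x y k) (nat (d + int (n - 1))) else 0)"
proof -
  let ?S = "{1..n} - {k}"
  have "card ?S = n - 1" using k by simp
  hence deg: "(\<Sum>i\<in>?S. int (p i) - 1) = d \<longleftrightarrow> int (\<Sum>i\<in>?S. p i) = d + int (n - 1)" for p
    by (auto simp: sum_subtractf)
  show ?thesis
  proof (cases "d + int (n - 1) \<ge> 0")
    case True
    have "{p \<in> omitted_exponents n k. (\<Sum>i\<in>?S. int (p i) - 1) = d} =
          {p \<in> ?S \<rightarrow>\<^sub>E UNIV. (\<Sum>i\<in>?S. p i) = nat (d + int (n - 1))}"
      unfolding omitted_exponents_def deg using True by (intro Collect_cong) linarith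
    thus ?thesis using True
      by (simp only: Omega_homogeneous_def Omega_fps_def Omega_term_eq[OF k] fps_sum_nth
           fps_nth_prod_PiE[OF finite_Diff[OF finite_atLeastAtMost]] if_True)
         (rule sum.swap)
  next
    case False
    hence "{p \<in> omitted_exponents n k. (\<Sum>i\<in>?S. int (p i) - 1) = d} = {}"
      unfolding deg by (metis (mono_tags, lifting) Collect_empty_eq of_nat_0_le_iff)
    thus ?thesis using False by (simp only: Omega_homogeneous_def sum.empty if_False)
  qed
qed

lemma sum_Omega_homogeneous_eq_0: "(\<Sum>k=1..n. Omega_homogeneous n a x y k d) = 0"
proof -
  have "(\<Sum>k=1..n. fps_nth (Omega_fps n a x y k) m) = 0" for m
    using sum_Omega_fps_eq_0 by (metis fps_sum_nth fps_zero_nth)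
  moreover have "(\<Sum>k=1..n. Omega_homogeneous n a x y k d) = (\<Sum>k=1..n.
      if d + int (n - 1) \<ge> 0 then fps_nth (Omega_fps n a x y k) (nat (d + int (n - 1))) else 0)"
    by (intro sum.cong refl Omega_homogeneous_eq)
  ultimately show ?thesis by (cases "d + int (n - 1) \<ge> 0") (simp_all only: if_True if_False sum.neutral_const)
qed

lemma Omega_summable:
  assumes k: "k \<in> {1..n}" and small: "\<And>i. i \<in> {1..n} \<Longrightarrow> cmod (y i) < 2 * pi * real (a i)"
  shows "Omega_summable n a x y k"
  unfolding Omega_summable_def Omega_term_eq[OF k] omitted_exponents_def
proof -
  have "(\<lambda>j. norm (fps_nth (bernoulli_fps (frac (dedekind_arg a x k h i))
          (y i / of_nat (a i))) j)) summable_on UNIV" if i: "i \<in> {1..n} - {k}" for h i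
  proof -
    have "cmod (y i / of_nat (a i)) < 2 * pi"
      using small[of i] a_ge_1[of i] i by (simp add: norm_divide divide_less_eq)
    thus ?thesis
      using bernoulli_fps_abs_summable[of "y i / of_nat (a i)"] scaled_y_nonzero[of i] i
      by (intro norm_summable_imp_summable_on) simp_all
  qed
  hence "(\<lambda>p. \<Prod>i\<in>{1..n} - {k}. fps_nth
      (bernoulli_fps (frac (dedekind_arg a x k h i)) (y i / of_nat (a i))) (p i))
      summable_on ({1..n} - {k} \<rightarrow>\<^sub>E UNIV)" for h
    by (intro abs_summable_summable[OF abs_summable_on_prod_PiE]) auto
  thus "(\<lambda>p. \<Sum>h = 0..<a k. \<Prod>i\<in>{1..n} - {k}. fps_nth
      (bernoulli_fps (frac (dedekind_arg a x k h i)) (y i / of_nat (a i))) (p i))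
      summable_on ({1..n} - {k} \<rightarrow>\<^sub>E UNIV)"
    by (intro has_sum_imp_summable[OF has_sum_finite_sum[OF _ has_sum_infsum]]) auto
qed

text \<open>
  The exponent tuples are partitioned by total degree. Each class is finite, because the exponents are
  nonnegative with prescribed sum.
\<close>

lemma has_sum_Omega_homogeneous:
  assumes k: "k \<in> {1..n}" and "Omega_summable n a x y k"
  shows "(Omega_homogeneous n a x y k has_sum Omega n a x y k) UNIV"
proof -
  let ?S = "{1..n} - {k}"
  let ?F = "\<lambda>d. {p \<in> omitted_exponents n k. (\<Sum>i\<in>?S. int (p i) - 1) = d}"
  let ?f = "Omega_term n a x y k"
  have "?F d \<subseteq> ?S \<rightarrow>\<^sub>E {..nat (d + int (card ?S))}" for d
  proof
    fix p assume p: "p \<in> ?F d"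
    hence "int (\<Sum>i\<in>?S. p i) = d + int (card ?S)" by (auto simp: sum_subtractf)
    hence "(\<Sum>i\<in>?S. p i) = nat (d + int (card ?S))" by linarith
    hence "p i \<le> nat (d + int (card ?S))" if "i \<in> ?S" for i
      using member_le_sum[of i ?S p] that by simp
    thus "p \<in> ?S \<rightarrow>\<^sub>E {..nat (d + int (card ?S))}"
      using p by (auto simp: omitted_exponents_def PiE_iff)
  qed
  hence fin: "finite (?F d)" for d
    by (rule finite_subset) (auto intro!: finite_PiE)
  have bij: "bij_betw snd (Sigma UNIV ?F) (omitted_exponents n k)"
    by (rule bij_betwI[of _ _ _ "\<lambda>p. (\<Sum>i\<in>?S. int (p i) - 1, p)"]) auto
  have "(?f has_sum Omega n a x y k) (omitted_exponents n k)"
    using assms(2) unfolding Omega_def Omega_summable_def by (rule has_sum_infsum)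
  hence "((\<lambda>q. ?f (snd q)) has_sum Omega n a x y k) (Sigma UNIV ?F)"
    using has_sum_reindex_bij_betw[OF bij] by blast
  thus ?thesis
    by (rule has_sum_SigmaD) (use fin in \<open>auto simp: Omega_homogeneous_def intro!: has_sum_finite\<close>)
qed

lemma sum_Omega_eq_0:
  assumes "\<And>k. k \<in> {1..n} \<Longrightarrow> Omega_summable n a x y k"
  shows "(\<Sum>k=1..n. Omega n a x y k) = 0"
proof -
  have "((\<lambda>d. \<Sum>k=1..n. Omega_homogeneous n a x y k d) has_sum (\<Sum>k=1..n. Omega n a x y k)) UNIV"
    by (intro has_sum_finite_sum has_sum_Omega_homogeneous assms) simp_all
  thus ?thesis
    unfolding sum_Omega_homogeneous_eq_0 using has_sum_0_simp has_sum_unique by blast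
qed

end

section \<open>The reciprocity law\<close>

theorem theorem2:
  fixes n :: nat and a :: "nat \<Rightarrow> nat" and x :: "nat \<Rightarrow> real" and y :: "nat \<Rightarrow> complex"
  assumes "\<forall>i\<in>{1..n}. a i \<ge> 1"
    and "\<forall>i\<in>{1..n}. \<forall>j\<in>{1..n}. i \<noteq> j \<longrightarrow> coprime (a i) (a j)"
    and "\<forall>i\<in>{1..n}. y i \<noteq> 0"
    and "(\<Sum>i=1..n. y i) = 0"
    and "\<forall>u v. 1 \<le> u \<and> u < v \<and> v \<le> n \<longrightarrow>
           (\<forall>hu hv :: int. (x u - of_int hu) / real (a u) - (x v - of_int hv) / real (a v) \<notin> \<int>)"
  shows "(\<forall>d. (\<Sum>k=1..n. Omega_homogeneous n a x y k d) = 0) \<and>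
         ((\<forall>i\<in>{1..n}. cmod (y i) < 2 * pi * real (a i)) \<longrightarrow>
            (\<forall>k\<in>{1..n}. Omega_summable n a x y k) \<and> (\<Sum>k=1..n. Omega n a x y k) = 0)"
proof -
  \<comment> \<open>A common discontinuity \<open>t\<close> would make the difference in the hypothesis equal to \<open>t - t = 0\<close>.\<close>
  have distinct: False
    if uv: "1 \<le> u" "u < v" "v \<le> n"
      and int: "real (a u) * t - x u \<in> \<int>" "real (a v) * t - x v \<in> \<int>" for u v t
  proof -
    obtain hu hv :: int where h: "real (a u) * t - x u = of_int hu" "real (a v) * t - x v = of_int hv"
      using int by (auto elim!: Ints_cases)
    have pos: "real (a u) > 0" "real (a v) > 0" using assms(1)[rule_format, of u] assms(1)[rule_format, of v] uv by simp_all
    have "(x u - of_int (- hu)) / real (a u) = t" "(x v - of_int (- hv)) / real (a v) = t"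
      using h pos by (simp_all add: field_simps)
    hence "(x u - of_int (- hu)) / real (a u) - (x v - of_int (- hv)) / real (a v) \<in> \<int>"
      by simp
    thus False using assms(5) uv by blast
  qed
  interpret generic_dedekind_data n a x y
  proof
    show "real (a j) * t - x j \<notin> \<int>"
      if "i \<in> {1..n}" "j \<in> {1..n}" "i \<noteq> j" "real (a i) * t - x i \<in> \<int>" for i j t
      using distinct[of i j t] distinct[of j i t] that by (cases "i < j") auto
  qed (use assms in auto)
  show ?thesis
    using sum_Omega_homogeneous_eq_0 Omega_summable sum_Omega_eq_0 by blast
qed

end
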